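(* For every integer $d\ge 2$, the $d$-dimensional hypercube $H_d$ satisfies $$\mathrm{box}(H_d) \geq \frac{\lceil \log_2 \log_2 d \rceil + 1}{2}.$$
   Context: The $d$-dimensional hypercube $H_d$ is the graph whose vertices are the $2^d$ binary strings of length $d$, two vertices being adjacent if and only if their strings differ in exactly one bit position. For a positive integer $k$, a $k$-box is a Cartesian product $R_1\times\cdots\times R_k\subseteq\mathbb{R}^k$ of closed intervals $R_i=[a_i,b_i]$. The boxicity $\mathrm{box}(G)$ of a finite simple graph $G$ is the minimum positive integer $k$ such that one can assign to each vertex of $G$ a $k$-box so that two distinct vertices are adjacent if and only if their boxes have non-empty intersection (in particular complete graphs have boxicity $1$). *)

theory Defs
  imports Complex_Main "HOL-Library.FuncSet" "Graph_Theory.Pair_Digraph"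
begin

(* A finite simple graph is a pair_graph: a finite, loopless, symmetric relation
   parcs G on the vertex set pverts G. *)

definition hypercube :: "nat \<Rightarrow> bool list pair_pre_digraph" where
  "hypercube d = \<lparr> pverts = {xs. length xs = d},
     parcs = {(xs, ys). length xs = d \<and> length ys = d \<and> card {i. i < d \<and> xs ! i \<noteq> ys ! i} = 1} \<rparr>"

(* The space R^k is the set of extensional functions {..<k} -> real;
   intervals [a, b] are taken with a \<le> b (single points allowed), so boxes are nonempty. *)

definition is_kbox :: "nat \<Rightarrow> (nat \<Rightarrow> real) set \<Rightarrow> bool" where
  "is_kbox k B \<longleftrightarrow> (\<exists>a b. (\<forall>i<k. a i \<le> b i) \<and> B = (\<Pi>\<^sub>E i\<in>{..<k}. {a i..b i}))"

definition box_representation ::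
    "nat \<Rightarrow> 'a pair_pre_digraph \<Rightarrow> ('a \<Rightarrow> (nat \<Rightarrow> real) set) \<Rightarrow> bool" where
  "box_representation k G R \<longleftrightarrow>
     (\<forall>v\<in>pverts G. is_kbox k (R v)) \<and>
     (\<forall>u\<in>pverts G. \<forall>v\<in>pverts G. u \<noteq> v \<longrightarrow> ((u, v) \<in> parcs G \<longleftrightarrow> R u \<inter> R v \<noteq> {}))"

(* The minimum is attained for every finite simple graph, see box_representation_exists. *)

definition boxicity :: "'a pair_pre_digraph \<Rightarrow> nat" where
  "boxicity G = (LEAST k. 0 < k \<and> (\<exists>R. box_representation k G R))"

lemma pair_graph_hypercube: "pair_graph (hypercube d)"
proof
  have "{xs :: bool list. set xs \<subseteq> UNIV \<and> length xs = d} = {xs. length xs = d}"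
    by simp
  then show fin: "finite (pverts (hypercube d))"
    using finite_lists_length_eq[of "UNIV :: bool set" d] by (simp add: hypercube_def)
  have "parcs (hypercube d) \<subseteq> pverts (hypercube d) \<times> pverts (hypercube d)"
    by (auto simp: hypercube_def)
  then show "finite (parcs (hypercube d))"
    using fin by (meson finite_SigmaI finite_subset)
  show "fst e \<in> pverts (hypercube d)" "snd e \<in> pverts (hypercube d)" "fst e \<noteq> snd e"
    if "e \<in> parcs (hypercube d)" for e
    using that by (cases e; fastforce simp: hypercube_def)+
  have eq: "{i. i < d \<and> xs ! i \<noteq> ys ! i} = {i. i < d \<and> ys ! i \<noteq> xs ! i}" for xs ys :: "bool list"
    by auto
  have "(ys, xs) \<in> parcs (hypercube d)" if "(xs, ys) \<in> parcs (hypercube d)" for xs ys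
    using that eq[of xs ys] by (simp add: hypercube_def)
  then show "symmetric (with_proj (hypercube d))"
    unfolding symmetric_def with_proj_simps by (rule symI)
qed

lemma box_representation_exists:
  assumes "pair_graph G"
  shows "\<exists>k>0. \<exists>R. box_representation k G R"
proof -
  interpret pair_graph G by fact
  define n where "n = card (pverts G)"
  obtain h where h: "bij_betw h {..<n} (pverts G)"
    using ex_bij_betw_nat_finite[OF finite_verts] by (auto simp: n_def atLeast0LessThan)
  have sym: "(v, u) \<in> parcs G" if "(u, v) \<in> parcs G" for u v
    using that by (rule arcs_symmetric)
  define a b where "a = (\<lambda>v i. if i < n \<and> v \<noteq> h i \<and> (h i, v) \<notin> parcs G then 1 else 0 :: real)"
    and "b = (\<lambda>v i. if i < n \<and> v = h i then 0 else 1 :: real)"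
  define R where "R = (\<lambda>v. \<Pi>\<^sub>E i\<in>{..<Suc n}. {a v i..b v i})"
  have le: "a v i \<le> b v i" for v i
    by (simp add: a_def b_def)
  have "is_kbox (Suc n) (R v)" for v
    unfolding is_kbox_def R_def using le by blast
  moreover have "(u, v) \<in> parcs G \<longleftrightarrow> R u \<inter> R v \<noteq> {}"
    if u: "u \<in> pverts G" and "v \<in> pverts G" and neq: "u \<noteq> v" for u v
  proof
    assume uv: "(u, v) \<in> parcs G"
    have "a u i \<le> b v i" "a v i \<le> b u i" for i
      using uv sym[OF uv] neq by (auto simp: a_def b_def)
    then have "(\<lambda>i\<in>{..<Suc n}. max (a u i) (a v i)) \<in> R u \<inter> R v"
      unfolding R_def using le by (intro IntI restrict_PiE_iff[THEN iffD2] ballI) simp_all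
    then show "R u \<inter> R v \<noteq> {}" by blast
  next
    assume "R u \<inter> R v \<noteq> {}"
    then obtain x where x: "x \<in> R u" "x \<in> R v" by blast
    have "u \<in> h ` {..<n}"
      using u bij_betw_imp_surj_on[OF h] by simp
    then obtain i where i: "i < n" "h i = u" by auto
    then have "i \<in> {..<Suc n}" by simp
    then have "x i \<in> {a u i..b u i}" "x i \<in> {a v i..b v i}"
      using x unfolding R_def by (blast dest: PiE_mem)+
    then have "a v i \<le> b u i" by simp
    then show "(u, v) \<in> parcs G"
      using i neq by (auto simp: a_def b_def split: if_splits)
  qed
  ultimately show ?thesis
    unfolding box_representation_def by (intro exI[of _ "Suc n"] conjI exI[of _ R]) simp_all
qed

end

theory Submission
  imports Defs
begin

text \<open>
  Write \<open>e X\<close> for the vertex of the hypercube with support \<open>X\<close>. In a representation by \<open>k\<close>-boxes,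
  the left and right endpoints of the boxes of the vertices \<open>e {x}\<close> are \<open>2k\<close> real functions on \<open>d\<close>
  points \<open>x\<close>. Sort the points by one of them and apply the Erdos-Szekeres theorem to each of the
  others in turn: if \<open>d > 2^(2^(2k-1))\<close>, some \<open>b\<close> lies between some \<open>a\<close> and \<open>c\<close> with respect to all
  these functions. Then every box meeting those of \<open>e {a}\<close> and \<open>e {c}\<close> meets that of \<open>e {b}\<close>. But
  \<open>e {a, c}\<close> is adjacent to \<open>e {a}\<close> and \<open>e {c}\<close> and not to \<open>e {b}\<close>.
\<close>

text \<open>Take for \<open>h x\<close> the largest size of a \<open>P\<close>-chain in
  \<open>S\<close> whose greatest element is \<open>x\<close>. A largest chain ending at
  \<open>x\<close> can be extended by any later \<open>y\<close> with \<open>P x y\<close>, because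
  transitivity passes \<open>P\<close> from \<open>x\<close> to all members of the chain. So the
  height strictly grows.\<close>

lemma chain_height_exists:
  fixes S :: "'a::linorder set"
  assumes fin: "finite S" and trans: "transp P"
  obtains h :: "'a \<Rightarrow> nat"
  where "\<And>x. x \<in> S \<Longrightarrow> 0 < h x"
    and "\<And>x. x \<in> S \<Longrightarrow> \<exists>T\<subseteq>S. card T = h x \<and> (\<forall>y\<in>T. \<forall>z\<in>T. y < z \<longrightarrow> P y z)"
    and "\<And>x y. \<lbrakk>x \<in> S; y \<in> S; x < y; P x y\<rbrakk> \<Longrightarrow> h x < h y"
proof -
  define C where "C x = {T. T \<subseteq> S \<and> x \<in> T \<and> (\<forall>y\<in>T. y \<le> x) \<and> (\<forall>y\<in>T. \<forall>z\<in>T. y < z \<longrightarrow> P y z)}" for x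
  define h where "h x = Max (card ` C x)" for x
  have finC: "finite (card ` C x)" for x
    using fin by (auto simp: C_def intro: finite_subset[of _ "Pow S"])
  have single: "{x} \<in> C x" if "x \<in> S" for x
    using that by (simp add: C_def)
  have attained: "\<exists>T\<in>C x. card T = h x" if "x \<in> S" for x
    using Max_in[OF finC] single[OF that] unfolding h_def by fastforce
  have le: "card T \<le> h x" if "T \<in> C x" for T x
    unfolding h_def using finC that by (intro Max_ge) auto
  show ?thesis
  proof
    show "0 < h x" if "x \<in> S" for x
      using le[OF single[OF that]] by simp
    show "\<exists>T\<subseteq>S. card T = h x \<and> (\<forall>y\<in>T. \<forall>z\<in>T. y < z \<longrightarrow> P y z)" if "x \<in> S" for x
      using attained[OF that] by (auto simp: C_def)
    show "h x < h y" if xy: "x \<in> S" "y \<in> S" "x < y" "P x y" for x y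
    proof -
      obtain T where T: "T \<in> C x" "card T = h x"
        using attained[OF \<open>x \<in> S\<close>] by blast
      have below: "z < y" if "z \<in> T" for z
        using that T(1) xy(3) by (auto simp: C_def)
      have Py: "P z y" if "z \<in> T" for z
        using that T(1) xy transpD[OF trans, of z x y] by (cases "z = x") (auto simp: C_def)
      have "P w z" if "w \<in> insert y T" "z \<in> insert y T" "w < z" for w z
        using that below[of w] below[of z] Py[of w] T(1) by (auto simp: C_def)
      moreover have "insert y T \<subseteq> S"
        using T(1) xy(2) by (simp add: C_def)
      ultimately have "insert y T \<in> C y"
        using below by (auto simp: C_def intro: less_imp_le)
      moreover have "finite T" "y \<notin> T"
        using T(1) xy fin by (auto simp: C_def intro: finite_subset)
      ultimately show ?thesis
        using le[of "insert y T" y] T(2) by simp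
    qed
  qed
qed

text \<open>Pigeonhole on labels: \<open>u x\<close> and \<open>v x\<close> are the lengths of the
  longest weakly increasing and weakly decreasing chains ending at \<open>x\<close>. If no monotone
  set has more than \<open>n\<close> points, all labels lie in an \<open>n\<close> by
  \<open>n\<close> grid, yet distinct points get distinct labels.\<close>

theorem Erdos_Szekeres:
  fixes f :: "'a::linorder \<Rightarrow> 'b::linorder"
  assumes fin: "finite S" and card: "n * n < card S"
  shows "\<exists>T\<subseteq>S. n < card T \<and> (mono_on T f \<or> antimono_on T f)"
proof (rule ccontr)
  assume none: "\<not> ?thesis"
  have le: "transp (\<lambda>x y. f x \<le> f y)" and ge: "transp (\<lambda>x y. f y \<le> f x)"
    by (auto intro!: transpI)
  obtain u where u: "\<And>x. x \<in> S \<Longrightarrow> 0 < u x"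
    "\<And>x. x \<in> S \<Longrightarrow> \<exists>T\<subseteq>S. card T = u x \<and> (\<forall>y\<in>T. \<forall>z\<in>T. y < z \<longrightarrow> f y \<le> f z)"
    "\<And>x y. \<lbrakk>x \<in> S; y \<in> S; x < y; f x \<le> f y\<rbrakk> \<Longrightarrow> u x < u y"
    by (rule chain_height_exists[OF fin le]) (rule that)
  obtain v where v: "\<And>x. x \<in> S \<Longrightarrow> 0 < v x"
    "\<And>x. x \<in> S \<Longrightarrow> \<exists>T\<subseteq>S. card T = v x \<and> (\<forall>y\<in>T. \<forall>z\<in>T. y < z \<longrightarrow> f z \<le> f y)"
    "\<And>x y. \<lbrakk>x \<in> S; y \<in> S; x < y; f y \<le> f x\<rbrakk> \<Longrightarrow> v x < v y"
    by (rule chain_height_exists[OF fin ge]) (rule that)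
  have "u x \<le> n" if x: "x \<in> S" for x
  proof -
    obtain T where T: "T \<subseteq> S" "card T = u x" "\<forall>y\<in>T. \<forall>z\<in>T. y < z \<longrightarrow> f y \<le> f z"
      using u(2)[OF x] by blast
    then have "mono_on T f"
      by (metis mono_onI order_le_less)
    then show ?thesis
      using none T by (metis not_le)
  qed
  moreover have "v x \<le> n" if x: "x \<in> S" for x
  proof -
    obtain T where T: "T \<subseteq> S" "card T = v x" "\<forall>y\<in>T. \<forall>z\<in>T. y < z \<longrightarrow> f z \<le> f y"
      using v(2)[OF x] by blast
    then have "antimono_on T f"
      by (metis monotone_onI order_le_less)
    then show ?thesis
      using none T by (metis not_le)
  qed
  ultimately have "(\<lambda>x. (u x, v x)) ` S \<subseteq> {1..n} \<times> {1..n}"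
    using u(1) v(1) by (auto simp: Suc_le_eq)
  \<comment> \<open>For \<open>x < y\<close>, either \<open>f x \<le> f y\<close> and
    \<open>u\<close> grows, or \<open>f y \<le> f x\<close> and \<open>v\<close> grows.\<close>
  moreover have "inj_on (\<lambda>x. (u x, v x)) S"
    by (rule linorder_inj_onI') (metis u(3) v(3) linear order_less_irrefl prod.inject)
  ultimately have "card S \<le> card ({1..n} \<times> {1..n})"
    by (metis card_inj_on_le finite_SigmaI finite_atLeastAtMost)
  then show False
    using card by simp
qed

text \<open>Each function costs a square root of the number of points, and
  \<open>2 ^ 2 ^ (m + 1)\<close> is the square of \<open>2 ^ 2 ^ m\<close>. When no function is left
  the bound is 2, so at least three points survive.\<close>

lemma common_monotone_subset:
  fixes F :: "('a::linorder \<Rightarrow> 'b::linorder) set"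
  assumes "finite F" "finite S" "2 ^ 2 ^ card F < card S"
  shows "\<exists>T\<subseteq>S. 2 < card T \<and> (\<forall>f\<in>F. mono_on T f \<or> antimono_on T f)"
  using assms
proof (induction F arbitrary: S)
  case empty
  then show ?case by auto
next
  case (insert g F)
  have "(2::nat) ^ 2 ^ card F * 2 ^ 2 ^ card F < card S"
    using insert.hyps insert.prems by (simp flip: power_add mult_2)
  then obtain S' where S': "S' \<subseteq> S" "2 ^ 2 ^ card F < card S'" "mono_on S' g \<or> antimono_on S' g"
    using Erdos_Szekeres[OF insert.prems(1)] by blast
  then obtain T where "T \<subseteq> S'" "2 < card T" "\<forall>f\<in>F. mono_on T f \<or> antimono_on T f"
    using insert.IH insert.prems(1) by (meson finite_subset)
  then show ?case
    using S' by (metis insert_iff monotone_on_subset order_trans)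
qed

text \<open>Betweenness ignores the direction of an order, so increasing and decreasing functions
  serve equally well. Sorting by one function makes it monotone for free, which saves one in the
  exponent.\<close>

lemma common_between:
  fixes F :: "('a \<Rightarrow> 'b::linorder) set"
  assumes "finite F" "finite S" "2 ^ 2 ^ (card F - 1) < card S"
  obtains a b c where "a \<in> S" "b \<in> S" "c \<in> S" "a \<noteq> b" "b \<noteq> c" "a \<noteq> c"
    "\<And>f. f \<in> F \<Longrightarrow> (f a \<le> f b \<and> f b \<le> f c) \<or> (f c \<le> f b \<and> f b \<le> f a)"
proof -
  \<comment> \<open>If \<open>F\<close> is empty any \<open>g\<close> will do, since the truncated
    \<open>card F - 1\<close> is then 0.\<close>
  obtain g where g: "card (F - {g}) = card F - 1"
    by (cases "F = {}") (simp, metis card_Diff_singleton ex_in_conv)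
  obtain ys where ys: "set ys = S" "distinct ys"
    using finite_distinct_list[OF assms(2)] by blast
  define xs where "xs = sort_key g ys"
  have xs: "set xs = S" "distinct xs" "sorted (map g xs)"
    using ys by (simp_all add: xs_def)
  \<comment> \<open>The points carry no order of their own, so the remaining functions are read on
    positions in the sorted list. Distinct functions may agree there, hence only an upper bound on
    \<open>card F'\<close>.\<close>
  define F' where "F' = (\<lambda>f i. f (xs ! i)) ` (F - {g})"
  have "card F' \<le> card F - 1"
    unfolding F'_def using g assms(1) card_image_le[of "F - {g}"] by (metis finite_Diff)
  then have "(2::nat) ^ 2 ^ card F' \<le> 2 ^ 2 ^ (card F - 1)"
    by (intro power_increasing) auto
  moreover have "card {..<length xs} = card S"
    using distinct_card[OF xs(2)] xs(1) by simp
  ultimately have "2 ^ 2 ^ card F' < card {..<length xs}"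
    using assms(3) by (metis le_less_trans)
  then obtain T where T: "T \<subseteq> {..<length xs}" "2 < card T"
      "\<forall>f\<in>F'. mono_on T f \<or> antimono_on T f"
    using common_monotone_subset[of F' "{..<length xs}"] assms(1) unfolding F'_def by auto
  obtain i j k where ijk: "i \<in> T" "j \<in> T" "k \<in> T" "i < j" "j < k"
  proof -
    define t where "t = sorted_list_of_set T"
    have "finite T" using T(1) finite_subset by blast
    then have "length t = card T" "set t = T" "sorted_wrt (<) t"
      by (simp_all add: t_def)
    then show ?thesis
      using that[of "t ! 0" "t ! 1" "t ! 2"] T(2)
      by (metis One_nat_def lessI less_trans nth_mem numeral_2_eq_2 sorted_wrt_nth_less zero_less_Suc)
  qed
  then have len: "i < length xs" "j < length xs" "k < length xs"
    using T(1) by auto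
  show ?thesis
  proof (rule that[of "xs ! i" "xs ! j" "xs ! k"])
    show "xs ! i \<in> S" "xs ! j \<in> S" "xs ! k \<in> S"
      using xs(1) len nth_mem by auto
    show "xs ! i \<noteq> xs ! j" "xs ! j \<noteq> xs ! k" "xs ! i \<noteq> xs ! k"
      using xs(2) len ijk by (simp_all add: nth_eq_iff_index_eq)
    fix f assume "f \<in> F"
    show "(f (xs ! i) \<le> f (xs ! j) \<and> f (xs ! j) \<le> f (xs ! k)) \<or>
          (f (xs ! k) \<le> f (xs ! j) \<and> f (xs ! j) \<le> f (xs ! i))"
    proof (cases "f = g")
      case True
      have "g (xs ! i) \<le> g (xs ! j)" "g (xs ! j) \<le> g (xs ! k)"
        using sorted_nth_mono[OF xs(3), of i j] sorted_nth_mono[OF xs(3), of j k] ijk len by simp_all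
      then show ?thesis
        using True by simp
    next
      case False
      then have "mono_on T (\<lambda>i. f (xs ! i)) \<or> antimono_on T (\<lambda>i. f (xs ! i))"
        using T(3) \<open>f \<in> F\<close> by (auto simp: F'_def)
      then show ?thesis
        using ijk by (auto simp: monotone_on_def)
    qed
  qed
qed

text \<open>Products intersect coordinatewise, and a product is empty exactly when a factor is. Two
  nonempty intervals are disjoint exactly when one ends before the other begins.\<close>

lemma PiE_atLeastAtMost_Int_eq_empty_iff:
  fixes a b a' b' :: "'i \<Rightarrow> 'b::linorder"
  assumes "\<And>i. i \<in> I \<Longrightarrow> a i \<le> b i" "\<And>i. i \<in> I \<Longrightarrow> a' i \<le> b' i"
  shows "(\<Pi>\<^sub>E i\<in>I. {a i..b i}) \<inter> (\<Pi>\<^sub>E i\<in>I. {a' i..b' i}) = {} \<longleftrightarrow>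
    (\<exists>i\<in>I. b i < a' i \<or> b' i < a i)"
proof -
  have "{a i..b i} \<inter> {a' i..b' i} = {} \<longleftrightarrow> b i < a' i \<or> b' i < a i" if "i \<in> I" for i
    unfolding Int_atLeastAtMost atLeastatMost_empty_iff min.bounded_iff max.bounded_iff
    using assms[OF that] by (meson not_le)
  then show ?thesis
    by (simp add: PiE_Int PiE_eq_empty_iff cong: bex_cong)
qed

text \<open>This is the vertex \<open>e X\<close> of the overview. Elements of \<open>X\<close> from
  \<open>d\<close> on are lost, so faithful use requires \<open>X \<subseteq> {..<d}\<close>;
  Hamming distance is then the size of the symmetric difference.\<close>

definition vertex_of :: "nat \<Rightarrow> nat set \<Rightarrow> bool list" where
  "vertex_of d X = map (\<lambda>i. i \<in> X) [0..<d]"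

lemma vertex_of_in_hypercube: "vertex_of d X \<in> pverts (hypercube d)"
  by (simp add: vertex_of_def hypercube_def)

lemma vertex_of_adjacent_iff:
  assumes "X \<subseteq> {..<d}" "Y \<subseteq> {..<d}"
  shows "(vertex_of d X, vertex_of d Y) \<in> parcs (hypercube d) \<longleftrightarrow> card (sym_diff X Y) = 1"
proof -
  have "{i. i < d \<and> vertex_of d X ! i \<noteq> vertex_of d Y ! i} = sym_diff X Y"
    using assms by (auto simp: vertex_of_def)
  then show ?thesis
    by (simp add: hypercube_def vertex_of_def)
qed

lemma vertex_of_eq_iff:
  assumes "X \<subseteq> {..<d}" "Y \<subseteq> {..<d}"
  shows "vertex_of d X = vertex_of d Y \<longleftrightarrow> X = Y"
  using assms by (auto simp: vertex_of_def)

lemma box_representation_hypercube_bound: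
  assumes rep: "box_representation k (hypercube d) R"
  shows "d \<le> 2 ^ 2 ^ (2 * k - 1)"
proof (rule ccontr)
  assume large: "\<not> ?thesis"
  obtain l r where le: "\<And>v i. v \<in> pverts (hypercube d) \<Longrightarrow> i < k \<Longrightarrow> l v i \<le> r v i"
    and R: "\<And>v. v \<in> pverts (hypercube d) \<Longrightarrow> R v = (\<Pi>\<^sub>E i\<in>{..<k}. {l v i..r v i})"
  proof -
    have "\<exists>a b. (\<forall>i<k. a i \<le> b i) \<and> R v = (\<Pi>\<^sub>E i\<in>{..<k}. {a i..b i})" if "v \<in> pverts (hypercube d)" for v
      using rep that unfolding box_representation_def is_kbox_def by blast
    then show ?thesis
      using that by metis
  qed
  have disjoint_iff: "R (vertex_of d X) \<inter> R (vertex_of d Y) = {} \<longleftrightarrow>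
      (\<exists>i<k. r (vertex_of d X) i < l (vertex_of d Y) i \<or> r (vertex_of d Y) i < l (vertex_of d X) i)"
    for X Y
    using PiE_atLeastAtMost_Int_eq_empty_iff[of "{..<k}" "l (vertex_of d X)" "r (vertex_of d X)"
        "l (vertex_of d Y)" "r (vertex_of d Y)"]
    by (simp add: R le vertex_of_in_hypercube Bex_def)
  have meet_iff: "R (vertex_of d X) \<inter> R (vertex_of d Y) \<noteq> {} \<longleftrightarrow> card (sym_diff X Y) = 1"
    if "X \<subseteq> {..<d}" "Y \<subseteq> {..<d}" "X \<noteq> Y" for X Y
    using rep that unfolding box_representation_def
    by (metis vertex_of_adjacent_iff vertex_of_eq_iff vertex_of_in_hypercube)
  define L where "L i x = l (vertex_of d {x}) i" for i x
  define U where "U i x = r (vertex_of d {x}) i" for i x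
  define F where "F = L ` {..<k} \<union> U ` {..<k}"
  \<comment> \<open>Endpoint functions may coincide, but this only shrinks \<open>F\<close> and
    weakens the size that \<open>common_between\<close> demands.\<close>
  have "card F \<le> k + k"
    unfolding F_def by (metis add_mono card_Un_le card_image_le card_lessThan finite_lessThan order_trans)
  then have "(2::nat) ^ 2 ^ (card F - 1) \<le> 2 ^ 2 ^ (2 * k - 1)"
    by (intro power_increasing) auto
  then have "2 ^ 2 ^ (card F - 1) < card {..<d}"
    using large unfolding not_le card_lessThan by (rule le_less_trans)
  moreover have "finite F"
    by (simp add: F_def)
  ultimately obtain a b c where abc: "a < d" "b < d" "c < d" "a \<noteq> b" "b \<noteq> c" "a \<noteq> c"
    and between: "\<And>f. f \<in> F \<Longrightarrow> (f a \<le> f b \<and> f b \<le> f c) \<or> (f c \<le> f b \<and> f b \<le> f a)"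
    using common_between[of F "{..<d}"] by (metis finite_lessThan lessThan_iff)
  \<comment> \<open>The vertex of \<open>{a, c}\<close> is at distance 1 from those of
    \<open>{a}\<close> and \<open>{c}\<close>, but at distance 3 from that of
    \<open>{b}\<close>.\<close>
  have "sym_diff {a, c} {a} = {c}" "sym_diff {a, c} {c} = {a}" "sym_diff {a, c} {b} = {a, b, c}"
    using abc by auto
  then have "R (vertex_of d {a, c}) \<inter> R (vertex_of d {a}) \<noteq> {}"
    "R (vertex_of d {a, c}) \<inter> R (vertex_of d {c}) \<noteq> {}"
    "R (vertex_of d {a, c}) \<inter> R (vertex_of d {b}) = {}"
    using meet_iff[of "{a, c}" "{a}"] meet_iff[of "{a, c}" "{c}"] meet_iff[of "{a, c}" "{b}"] abc
    by auto
  \<comment> \<open>Some coordinate \<open>i\<close> separates the boxes of \<open>{a, c}\<close>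
    and \<open>{b}\<close>, while those of \<open>{a}\<close> and \<open>{c}\<close> meet that of
    \<open>{a, c}\<close> in every coordinate.\<close>
  then obtain i where i: "i < k"
    and ac: "L i a \<le> r (vertex_of d {a, c}) i" "L i c \<le> r (vertex_of d {a, c}) i"
      "l (vertex_of d {a, c}) i \<le> U i a" "l (vertex_of d {a, c}) i \<le> U i c"
    and b: "r (vertex_of d {a, c}) i < L i b \<or> U i b < l (vertex_of d {a, c}) i"
    unfolding disjoint_iff L_def U_def by (meson not_le)
  have "L i \<in> F" "U i \<in> F"
    using i by (simp_all add: F_def)
  \<comment> \<open>By betweenness \<open>L i b\<close> is at most the larger of
    \<open>L i a\<close> and \<open>L i c\<close>, and \<open>U i b\<close> at least the smaller of
    \<open>U i a\<close> and \<open>U i c\<close>. So \<open>b\<close> can lie on neither side of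
    the interval of \<open>{a, c}\<close>.\<close>
  then show False
    using between[of "L i"] between[of "U i"] ac b by linarith
qed

theorem theorem4:
  fixes d :: nat
  assumes "d \<ge> 2"
  shows "real (boxicity (hypercube d)) \<ge> (real_of_int \<lceil>log 2 (log 2 (real d))\<rceil> + 1) / 2"
proof -
  define k where "k = boxicity (hypercube d)"
  \<comment> \<open>A representation exists, so the least \<open>k\<close> is attained and the bound
    on \<open>d\<close> applies to it.\<close>
  have "0 < k \<and> (\<exists>R. box_representation k (hypercube d) R)"
    unfolding k_def boxicity_def
    by (rule LeastI_ex) (use box_representation_exists[OF pair_graph_hypercube] in blast)
  then have "0 < k" and d: "d \<le> 2 ^ 2 ^ (2 * k - 1)"
    using box_representation_hypercube_bound by auto
  have "real d \<le> 2 ^ 2 ^ (2 * k - 1)"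
    using d by (metis of_nat_le_iff of_nat_numeral of_nat_power)
  then have "log 2 (real d) \<le> log 2 (2 ^ 2 ^ (2 * k - 1))"
    using assms by (subst log_le_cancel_iff) auto
  then have "log 2 (real d) \<le> 2 ^ (2 * k - 1)"
    by (simp add: log_nat_power)
  \<comment> \<open>Positivity, from \<open>d \<ge> 2\<close>, allows the second logarithm to be
    compared.\<close>
  moreover have "0 < log 2 (real d)"
    using assms by simp
  ultimately have "log 2 (log 2 (real d)) \<le> log 2 (2 ^ (2 * k - 1))"
    by (subst log_le_cancel_iff) auto
  then have "log 2 (log 2 (real d)) \<le> real (2 * k - 1)"
    by (simp add: log_nat_power)
  \<comment> \<open>The upper bound is an integer, so it also bounds the ceiling.\<close>
  then have "\<lceil>log 2 (log 2 (real d))\<rceil> \<le> int (2 * k - 1)"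
    by (simp add: ceiling_le_iff)
  \<comment> \<open>Since \<open>k\<close> is positive, the natural subtraction does not
    truncate.\<close>
  also have "\<dots> = 2 * int k - 1"
    using \<open>0 < k\<close> by simp
  finally have "real_of_int \<lceil>log 2 (log 2 (real d))\<rceil> \<le> real_of_int (2 * int k - 1)"
    by (simp only: of_int_le_iff)
  then show ?thesis
    unfolding k_def by simp
qed

end
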